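(* Consider an imprecise Markov chain with initial (marginal) model $\underline{E}_1$ and lower transition operator $\underline{\mathrm{T}}$. Assume that $\underline{\mathrm{T}}$ is Perron–Frobenius-like, with invariant lower expectation $\underline{E}_\infty$. Then for all $f\in\mathcal{G}(\mathcal{X})$: $$\liminf_{n\to\infty}\frac1n\sum_{k=1}^{n}\big[f(X_k)-\underline{E}_k(f)\big]\geq0\quad\text{strictly almost surely},$$ and consequently $$\liminf_{n\to\infty}\frac1n\sum_{k=1}^{n}f(X_k)\geq\underline{E}_\infty(f)\quad\text{strictly almost surely}.$$
   Context: Write $\mathbb{N}=\{1,2,\dots\}$, $\mathbb{N}_0=\mathbb{N}\cup\{0\}$. Let $\mathcal{X}$ be a non-empty finite set (state space). A situation is a finite string $x_{1:n}=(x_1,\dots,x_n)\in\mathcal{X}^n$, $n\in\mathbb{N}_0$; the empty string is $\square$. A path is an element $\omega=(\omega_1,\omega_2,\dots)$ of $\Omega:=\mathcal{X}^{\mathbb{N}}$; $\omega^n:=(\omega_1,\dots,\omega_n)$; $X_k(\omega):=\omega_k$. Events are subsets of $\Omega$. A gamble on a set $Y$ is a bounded function $Y\to\mathbb{R}$; $\mathcal{G}(Y)$ is the set of these. A lower expectation on $\mathcal{G}(Y)$ is a functional $\underline{E}\colon\mathcal{G}(Y)\to\mathbb{R}$ with $\underline{E}(f)\geq\inf f$, $\underline{E}(f+g)\geq\underline{E}(f)+\underline{E}(g)$ and $\underline{E}(\lambda f)=\lambda\underline{E}(f)$ for all gambles $f,g$ and real $\lambda\geq0$; its conjugate is $\overline{E}(f):=-\underline{E}(-f)$.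 An imprecise probability tree attaches to each situation $x_{1:n}$ a lower expectation $\underline{Q}(\cdot|x_{1:n})$ on $\mathcal{G}(\mathcal{X})$ (modelling the next state), with conjugate $\overline{Q}(\cdot|x_{1:n})$. It is an imprecise Markov chain if $\underline{Q}(\cdot|x_{1:n})=\underline{Q}(\cdot|x_n)$ for all $n\in\mathbb{N}$ and $x_{1:n}\in\mathcal{X}^n$. Its marginal model is $\underline{E}_1:=\underline{Q}(\cdot|\square)$, and its lower transition operator $\underline{\mathrm{T}}\colon\mathcal{G}(\mathcal{X})\to\mathcal{G}(\mathcal{X})$ is $\underline{\mathrm{T}}f(x):=\underline{Q}(f|x)$. $\underline{\mathrm{T}}$ is Perron–Frobenius-like if for every $f\in\mathcal{G}(\mathcal{X})$ the sequence $\underline{\mathrm{T}}^nf$ converges point-wise to a constant real number, denoted $\underline{E}_\infty(f)$; $\underline{E}_\infty$ is then a lower expectation, and it is the only lower expectation on $\mathcal{G}(\mathcal{X})$ with $\underline{E}_\infty\circ\underline{\mathrm{T}}=\underline{E}_\infty$. A real process is a real-valued map $\mathcal{F}$ on situations; $\Delta\mathcal{F}(x_{1:n})(x_{n+1}):=\mathcal{F}(x_{1:n+1})-\mathcal{F}(x_{1:n})$. A submartingale is a real process $\mathcal{M}$ with $\underline{Q}(\Delta\mathcal{M}(s)|s)\geq0$ for all situations $s$; a supermartingale is a real process with $\overline{Q}(\Delta\mathcal{M}(s)|s)\leq0$ for all $s$. A test supermartingale is a non-negative supermartingale $\mathcal{T}$ with $\mathcal{T}(\square)=1$. An event $A$ is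 strictly null if some test supermartingale $\mathcal{T}$ satisfies $\lim_{n\to\infty}\mathcal{T}(\omega^n)=+\infty$ for all $\omega\in A$. A statement about paths holds strictly almost surely if the set of paths where it fails is strictly null. For $k\in\mathbb{N}$ and $f\in\mathcal{G}(\mathcal{X})$, $\underline{E}_k(f)$ is the global lower expectation of $f(X_k)$: $\underline{E}_k(f):=\sup\{\mathcal{M}(\square):\mathcal{M}\text{ a submartingale with }\limsup_{n\to\infty}\mathcal{M}(\omega^n)\leq f(\omega_k)\text{ for all }\omega\in\Omega\}$, which is known to equal $\underline{E}_1(\underline{\mathrm{T}}^{k-1}f)$. *)

theory Defs
  imports Complex_Main "HOL-Library.Extended_Real"
begin

text \<open>The state space is a type \<open>'x\<close> of class \<^class>\<open>finite\<close>, so every function \<open>'x \<Rightarrow> real\<close> is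
  bounded, i.e. a gamble.\<close>

type_synonym 'x gamble = "'x \<Rightarrow> real"

definition lower_expectation :: "('x::finite gamble \<Rightarrow> real) \<Rightarrow> bool" where
  "lower_expectation E \<longleftrightarrow>
     (\<forall>f. (INF x. f x) \<le> E f) \<and>
     (\<forall>f g. E f + E g \<le> E (\<lambda>x. f x + g x)) \<and>
     (\<forall>f. \<forall>c\<ge>0. E (\<lambda>x. c * f x) = c * E f)"

definition conjugate :: "('x::finite gamble \<Rightarrow> real) \<Rightarrow> 'x gamble \<Rightarrow> real" where
  "conjugate E f = - E (\<lambda>x. - f x)"

text \<open>A situation \<open>x\<^sub>1, \<dots>, x\<^sub>n\<close> is the list \<open>[x\<^sub>1, \<dots>, x\<^sub>n]\<close>, with the most recent state last.
  Paths are indexed from \<open>0\<close>: the state at time \<open>k \<ge> 1\<close> is \<open>\<omega> (k - 1)\<close>.\<close>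

type_synonym 'x situation = "'x list"
type_synonym 'x path = "nat \<Rightarrow> 'x"

definition prefix_of :: "'x path \<Rightarrow> nat \<Rightarrow> 'x situation" where
  "prefix_of \<omega> n = map \<omega> [0..<n]"

definition state_at :: "nat \<Rightarrow> 'x path \<Rightarrow> 'x" where
  "state_at k \<omega> = \<omega> (k - 1)"

type_synonym 'x tree = "'x situation \<Rightarrow> 'x gamble \<Rightarrow> real"

definition imprecise_probability_tree :: "'x::finite tree \<Rightarrow> bool" where
  "imprecise_probability_tree Q \<longleftrightarrow> (\<forall>s. lower_expectation (Q s))"

definition imprecise_Markov_chain :: "'x::finite tree \<Rightarrow> bool" where
  "imprecise_Markov_chain Q \<longleftrightarrow>
     imprecise_probability_tree Q \<and> (\<forall>s. s \<noteq> [] \<longrightarrow> Q s = Q [last s])"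

definition lower_transition :: "'x::finite tree \<Rightarrow> 'x gamble \<Rightarrow> 'x gamble" where
  "lower_transition Q f = (\<lambda>x. Q [x] f)"

definition Perron_Frobenius_like :: "('x::finite gamble \<Rightarrow> 'x gamble) \<Rightarrow> bool" where
  "Perron_Frobenius_like T \<longleftrightarrow> (\<forall>f. \<exists>c. \<forall>x. (\<lambda>n. (T ^^ n) f x) \<longlonglongrightarrow> c)"

definition limit_expectation :: "('x::finite gamble \<Rightarrow> 'x gamble) \<Rightarrow> 'x gamble \<Rightarrow> real" where
  "limit_expectation T f = (THE c. \<forall>x. (\<lambda>n. (T ^^ n) f x) \<longlonglongrightarrow> c)"

type_synonym 'x process = "'x situation \<Rightarrow> real"

definition process_difference :: "'x process \<Rightarrow> 'x situation \<Rightarrow> 'x gamble" where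
  "process_difference F s = (\<lambda>x. F (s @ [x]) - F s)"

definition submartingale :: "'x::finite tree \<Rightarrow> 'x process \<Rightarrow> bool" where
  "submartingale Q M \<longleftrightarrow> (\<forall>s. Q s (process_difference M s) \<ge> 0)"

definition supermartingale :: "'x::finite tree \<Rightarrow> 'x process \<Rightarrow> bool" where
  "supermartingale Q M \<longleftrightarrow> (\<forall>s. conjugate (Q s) (process_difference M s) \<le> 0)"

definition test_supermartingale :: "'x::finite tree \<Rightarrow> 'x process \<Rightarrow> bool" where
  "test_supermartingale Q M \<longleftrightarrow> supermartingale Q M \<and> (\<forall>s. M s \<ge> 0) \<and> M [] = 1"

definition strictly_null :: "'x::finite tree \<Rightarrow> 'x path set \<Rightarrow> bool" where
  "strictly_null Q A \<longleftrightarrow>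
     (\<exists>M. test_supermartingale Q M \<and>
          (\<forall>\<omega>\<in>A. filterlim (\<lambda>n. M (prefix_of \<omega> n)) at_top sequentially))"

definition strictly_almost_surely :: "'x::finite tree \<Rightarrow> ('x path \<Rightarrow> bool) \<Rightarrow> bool" where
  "strictly_almost_surely Q P \<longleftrightarrow> strictly_null Q {\<omega>. \<not> P \<omega>}"

text \<open>The supremum below is a genuine one when \<open>Q\<close> is an imprecise probability tree and
  \<open>k \<ge> 1\<close>: the constant process with value \<open>INF x. f x\<close> qualifies, and \<open>M []\<close> is at most
  \<open>SUP x. f x\<close>, because from every situation a submartingale is non-decreasing along some successor.
  The limit superior is taken in the extended reals, since \<open>M\<close> may be unbounded along a path.\<close>

definition lower_expectation_at ::
    "'x::finite tree \<Rightarrow> nat \<Rightarrow> 'x gamble \<Rightarrow> real" where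
  "lower_expectation_at Q k f =
     Sup {M [] |M. submartingale Q M \<and>
        (\<forall>\<omega>. limsup (\<lambda>n. ereal (M (prefix_of \<omega> n))) \<le> ereal (f (state_at k \<omega>)))}"

end

theory Submission
  imports Defs
begin

text \<open>
  Let \<open>T\<close> be the lower transition operator, \<open>c\<close> the limit expectation of \<open>f\<close>, and \<open>E\<^sub>k f\<close> the lower
  expectation of \<open>f X\<^sub>k\<close>. The second claim, that time averages of \<open>f\<close> are asymptotically at least
  \<open>c\<close>, implies the first one path by path: \<open>E\<^sub>k f\<close> is at most the maximum of \<open>(T ^^ (k - 1)) f\<close>
  (\<open>lower_expectation_at_le\<close>), which tends to \<open>c\<close>, so that the averages of \<open>E\<^sub>k f\<close> have limit
  superior at most \<open>c\<close>.

  For the second claim, fix \<open>\<delta> > 0\<close>. The state space being finite, some iterate \<open>T ^^ m\<close> maps \<open>f\<close>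
  above \<open>c - \<delta>\<close> everywhere, and the sum \<open>h\<close> of the iterates \<open>(T ^^ j) f\<close> with \<open>j < m\<close> then satisfies
  the Poisson-type inequality \<open>T h \<ge> h - f + c - \<delta>\<close> (\<open>ex_Poisson_subsolution\<close>). Hence the increments
  \<open>h X\<^sub>k\<^sub>+\<^sub>1 - h X\<^sub>k + f X\<^sub>k - (c - \<delta>)\<close> are bounded, have non-negative lower expectation given the past,
  and sum to \<open>\<Sum>k\<le>n. (f X\<^sub>k - c + \<delta>)\<close> up to a bounded term. Betting a small fixed proportion of
  the capital against them is a test supermartingale that grows exponentially at the times when
  the time average is below \<open>c - 3 \<delta>\<close> (\<open>ex_test_supermartingale_small_averages\<close>).

  Two constructions finish the proof. A countable mixture (\<open>test_supermartingale_mixture\<close>) combines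
  the strategies for a sequence of values of \<open>\<delta>\<close> tending to \<open>0\<close>. It is only known to be unbounded
  along the bad paths, whereas strict nullity asks for divergence to infinity; this is repaired by
  stopping at a sequence of levels and mixing again (\<open>strictly_null_if_unbounded\<close>).
\<close>

section \<open>Lower expectations\<close>

lemma lower_expectation_superadditive:
  "lower_expectation E \<Longrightarrow> E f + E g \<le> E (\<lambda>x. f x + g x)"
  by (auto simp: lower_expectation_def)

lemma lower_expectation_scale:
  "lower_expectation E \<Longrightarrow> 0 \<le> c \<Longrightarrow> E (\<lambda>x. c * f x) = c * E f"
  by (auto simp: lower_expectation_def)

lemma lower_expectation_ge:
  fixes E :: "'x::finite gamble \<Rightarrow> real"
  assumes "lower_expectation E" and "\<And>x. c \<le> f x"
  shows "c \<le> E f"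
proof -
  have "c \<le> (INF x. f x)"
    by (rule cINF_greatest) (use assms in auto)
  also have "\<dots> \<le> E f"
    using assms(1) by (auto simp: lower_expectation_def)
  finally show ?thesis .
qed

lemma lower_expectation_zero:
  assumes "lower_expectation E"
  shows "E (\<lambda>x. 0) = 0"
  using lower_expectation_scale[OF assms, of 0 "\<lambda>x. 0"] by simp

lemma lower_expectation_const:
  assumes "lower_expectation E"
  shows "E (\<lambda>x. c) = c"
proof (rule antisym)
  have "E (\<lambda>x. c) + E (\<lambda>x. - c) \<le> 0"
    using lower_expectation_superadditive[OF assms, of "\<lambda>x. c" "\<lambda>x. - c"]
      lower_expectation_zero[OF assms] by simp
  moreover have "- c \<le> E (\<lambda>x. - c)"
    by (rule lower_expectation_ge[OF assms]) simp
  ultimately show "E (\<lambda>x. c) \<le> c" by simp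
  show "c \<le> E (\<lambda>x. c)"
    by (rule lower_expectation_ge[OF assms]) simp
qed

lemma lower_expectation_mono:
  assumes "lower_expectation E" and "\<And>x. f x \<le> g x"
  shows "E f \<le> E g"
proof -
  have "0 \<le> E (\<lambda>x. g x - f x)"
    by (rule lower_expectation_ge[OF assms(1)]) (simp add: assms(2))
  then show ?thesis
    using lower_expectation_superadditive[OF assms(1), of f "\<lambda>x. g x - f x"] by simp
qed

lemma lower_expectation_add_const:
  assumes "lower_expectation E"
  shows "E (\<lambda>x. f x + c) = E f + c"
proof (rule antisym)
  show "E f + c \<le> E (\<lambda>x. f x + c)"
    using lower_expectation_superadditive[OF assms, of f "\<lambda>x. c"]
    by (simp add: lower_expectation_const[OF assms])
  show "E (\<lambda>x. f x + c) \<le> E f + c"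
    using lower_expectation_superadditive[OF assms, of "\<lambda>x. f x + c" "\<lambda>x. - c"]
    by (simp add: lower_expectation_const[OF assms])
qed

lemma lower_expectation_sum_superadditive:
  fixes g :: "nat \<Rightarrow> 'x::finite gamble"
  assumes "lower_expectation E"
  shows "(\<Sum>i<n. E (g i)) \<le> E (\<lambda>x. \<Sum>i<n. g i x)"
proof (induction n)
  case 0
  then show ?case by (simp add: lower_expectation_zero[OF assms])
next
  case (Suc n)
  have "(\<Sum>i<Suc n. E (g i)) \<le> E (\<lambda>x. \<Sum>i<n. g i x) + E (g n)"
    using Suc by simp
  also have "\<dots> \<le> E (\<lambda>x. \<Sum>i<Suc n. g i x)"
    using lower_expectation_superadditive[OF assms, of "\<lambda>x. \<Sum>i<n. g i x" "g n"] by simp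
  finally show ?case .
qed

text \<open>The state space being finite, pointwise convergence is uniform, so that desirability is
  preserved in the limit.\<close>

lemma lower_expectation_limit_nonneg:
  fixes g :: "nat \<Rightarrow> 'x::finite gamble"
  assumes E: "lower_expectation E" and nonneg: "\<And>n. 0 \<le> E (g n)"
    and lim: "\<And>x. (\<lambda>n. g n x) \<longlonglongrightarrow> g' x"
  shows "0 \<le> E g'"
proof (rule field_le_epsilon)
  fix e :: real
  assume "0 < e"
  have "\<forall>\<^sub>F n in sequentially. \<forall>x. g n x < g' x + e"
    using lim \<open>0 < e\<close> by (intro eventually_all_finite order_tendstoD(2)) auto
  then obtain n where n: "g n x < g' x + e" for x
    by (auto simp: eventually_sequentially)
  have "0 \<le> E (g n)" by (rule nonneg)
  also have "\<dots> \<le> E (\<lambda>x. g' x + e)"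
    by (rule lower_expectation_mono[OF E]) (simp add: n less_imp_le)
  finally show "0 \<le> E g' + e"
    by (simp add: lower_expectation_add_const[OF E])
qed

section \<open>Supermartingales\<close>

lemma prefix_of_Suc: "prefix_of \<omega> (Suc n) = prefix_of \<omega> n @ [\<omega> n]"
  by (simp add: prefix_of_def)

lemma supermartingale_iff:
  "supermartingale Q M \<longleftrightarrow> (\<forall>s. 0 \<le> Q s (\<lambda>x. M s - M (s @ [x])))"
  by (simp add: supermartingale_def conjugate_def process_difference_def)

lemma sums_geometric_half: "(\<lambda>i. (1/2::real) ^ Suc i) sums 1"
  using power_half_series by simp

text \<open>The common bound \<open>B\<close> may depend on the situation; it makes the mixture finite everywhere.\<close>

lemma test_supermartingale_mixture:
  fixes Q :: "'x::finite tree" and M :: "nat \<Rightarrow> 'x process"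
  assumes Q: "imprecise_probability_tree Q"
    and M: "\<And>i. test_supermartingale Q (M i)"
    and bound: "\<And>i s. M i s \<le> B s"
  defines "U \<equiv> \<lambda>s. \<Sum>i. (1/2) ^ Suc i * M i s"
  shows "test_supermartingale Q U"
    and "(\<Sum>i<n. (1/2) ^ Suc i * M i s) \<le> U s"
    and "(1/2) ^ Suc i * M i s \<le> U s"
proof -
  have nonneg: "0 \<le> M i s" for i s
    using M by (simp add: test_supermartingale_def)
  have summable: "summable (\<lambda>i. (1/2) ^ Suc i * M i s)" for s
  proof (rule summable_comparison_test')
    show "summable (\<lambda>i. (1/2) ^ Suc i * B s)"
      using sums_summable[OF sums_geometric_half] by (rule summable_mult2)
    show "norm ((1/2) ^ Suc i * M i s) \<le> (1/2) ^ Suc i * B s" if "0 \<le> i" for i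
      using bound[of i s] nonneg[of i s] by (simp add: abs_mult)
  qed
  have partial: "(\<Sum>i<n. (1/2) ^ Suc i * M i s) \<le> U s" for n s
    unfolding U_def by (rule sum_le_suminf[OF summable]) (auto simp: nonneg)
  show "(\<Sum>i<n. (1/2) ^ Suc i * M i s) \<le> U s"
    by (rule partial)
  show "(1/2) ^ Suc i * M i s \<le> U s"
  proof -
    have "(1/2) ^ Suc i * M i s \<le> (\<Sum>j<Suc i. (1/2) ^ Suc j * M j s)"
      by (rule member_le_sum) (auto simp: nonneg)
    then show ?thesis
      using partial[of s "Suc i"] by linarith
  qed
  have "0 \<le> Q s (\<lambda>x. U s - U (s @ [x]))" for s
  proof (rule lower_expectation_limit_nonneg[where E = "Q s"])
    let ?g = "\<lambda>n x. \<Sum>i<n. (1/2) ^ Suc i * (M i s - M i (s @ [x]))"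
    show E: "lower_expectation (Q s)"
      using Q by (simp add: imprecise_probability_tree_def)
    show "0 \<le> Q s (?g n)" for n
    proof -
      have "0 \<le> (1/2) ^ Suc i * Q s (\<lambda>x. M i s - M i (s @ [x]))" for i
        using M[of i] by (simp add: test_supermartingale_def supermartingale_iff)
      then have "0 \<le> (\<Sum>i<n. Q s (\<lambda>x. (1/2) ^ Suc i * (M i s - M i (s @ [x]))))"
        by (intro sum_nonneg) (subst lower_expectation_scale[OF E], auto)
      also have "\<dots> \<le> Q s (?g n)"
        by (rule lower_expectation_sum_superadditive[OF E])
      finally show ?thesis .
    qed
    show "(\<lambda>n. ?g n x) \<longlonglongrightarrow> U s - U (s @ [x])" for x
      using tendsto_diff[OF summable_LIMSEQ[OF summable[of s]]
          summable_LIMSEQ[OF summable[of "s @ [x]"]]]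
      by (simp add: U_def right_diff_distrib sum_subtractf)
  qed
  moreover have "0 \<le> U s" for s
    unfolding U_def by (rule suminf_nonneg[OF summable]) (simp add: nonneg)
  moreover have "U [] = 1"
    using M sums_unique[OF sums_geometric_half] by (simp add: U_def test_supermartingale_def)
  ultimately show "test_supermartingale Q U"
    by (simp add: test_supermartingale_def supermartingale_iff)
qed

text \<open>The process \<open>U\<close> frozen from the first time that it reaches the level \<open>L\<close>, as a recursion on
  the reversed situation, whose head is the most recent state.\<close>

primrec stopped_rev :: "'x process \<Rightarrow> real \<Rightarrow> 'x list \<Rightarrow> real" where
  "stopped_rev U L [] = U []"
| "stopped_rev U L (x # r) = (if L \<le> stopped_rev U L r then stopped_rev U L r else U (rev (x # r)))"

text \<open>The same process as a function of the situation in its usual order.\<close>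

definition stopped_at_level :: "'x process \<Rightarrow> real \<Rightarrow> 'x process" where
  "stopped_at_level U L s = stopped_rev U L (rev s)"

lemma stopped_at_level_Nil: "stopped_at_level U L [] = U []"
  by (simp add: stopped_at_level_def)

lemma stopped_at_level_snoc:
  "stopped_at_level U L (s @ [x]) =
     (if L \<le> stopped_at_level U L s then stopped_at_level U L s else U (s @ [x]))"
  by (simp add: stopped_at_level_def)

lemma stopped_at_level_below:
  "stopped_at_level U L s < L \<Longrightarrow> stopped_at_level U L s = U s"
  by (cases s rule: rev_cases)
    (auto simp: stopped_at_level_Nil stopped_at_level_snoc split: if_splits)

lemma stopped_at_level_nonneg:
  "(\<And>s. 0 \<le> U s) \<Longrightarrow> 0 \<le> stopped_at_level U L s"
  by (induction s rule: rev_induct) (auto simp: stopped_at_level_Nil stopped_at_level_snoc)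

lemma stopped_at_level_bound:
  assumes "\<And>s. 0 \<le> U s"
  shows "stopped_at_level U L s \<le> (\<Sum>j\<le>length s. U (take j s))"
proof (induction s rule: rev_induct)
  case Nil
  then show ?case by (simp add: stopped_at_level_Nil)
next
  case (snoc x s)
  have "0 \<le> (\<Sum>j\<le>length s. U (take j s))"
    by (simp add: assms sum_nonneg)
  then show ?case
    using snoc assms[of "s @ [x]"] by (simp add: stopped_at_level_snoc)
qed

lemma test_supermartingale_stopped_at_level:
  fixes Q :: "'x::finite tree"
  assumes Q: "imprecise_probability_tree Q" and U: "test_supermartingale Q U"
  shows "test_supermartingale Q (stopped_at_level U L)"
proof -
  let ?V = "stopped_at_level U L"
  have "0 \<le> Q s (\<lambda>x. ?V s - ?V (s @ [x]))" for s
  proof (cases "L \<le> ?V s")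
    case True
    then show ?thesis
      using Q by (simp add: stopped_at_level_snoc lower_expectation_zero
          imprecise_probability_tree_def)
  next
    case False
    then show ?thesis
      using U stopped_at_level_below[of U L s]
      by (simp add: stopped_at_level_snoc test_supermartingale_def supermartingale_iff)
  qed
  then show ?thesis
    using U by (simp add: test_supermartingale_def supermartingale_iff stopped_at_level_nonneg
        stopped_at_level_Nil)
qed

lemma stopped_at_level_reached:
  assumes "L \<le> U (prefix_of \<omega> j)" and "j \<le> n"
  shows "L \<le> stopped_at_level U L (prefix_of \<omega> n)"
  using assms(2)
proof (induction n rule: dec_induct)
  case base
  then show ?case
    using assms(1) stopped_at_level_below[of U L "prefix_of \<omega> j"] by linarith
next
  case (step n)
  then show ?case by (simp add: prefix_of_Suc stopped_at_level_snoc)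
qed

text \<open>It is enough for a test supermartingale to be unbounded along the paths of an event: stopping
  it at the levels \<open>2, 4, 8, \<dots>\<close> and mixing the stopped processes with the weights
  \<open>1/2, 1/4, 1/8, \<dots>\<close> gains at least \<open>1\<close> for every level reached, and never loses it again.\<close>

lemma strictly_null_if_unbounded:
  fixes Q :: "'x::finite tree"
  assumes Q: "imprecise_probability_tree Q" and U: "test_supermartingale Q U"
    and unbounded: "\<And>\<omega> L. \<omega> \<in> A \<Longrightarrow> \<exists>n. L \<le> U (prefix_of \<omega> n)"
  shows "strictly_null Q A"
proof -
  define M where "M i = stopped_at_level U (2 ^ Suc i)" for i
  have "0 \<le> U s" for s
    using U by (simp add: test_supermartingale_def)
  then have bound: "M i s \<le> (\<Sum>j\<le>length s. U (take j s))" for i s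
    by (simp add: M_def stopped_at_level_bound)
  define V where "V s = (\<Sum>i. (1/2) ^ Suc i * M i s)" for s
  have test: "test_supermartingale Q (M i)" for i
    unfolding M_def by (rule test_supermartingale_stopped_at_level[OF Q U])
  note mixture = test_supermartingale_mixture[where Q = Q and M = M, OF Q test bound, folded V_def]
  have "filterlim (\<lambda>n. V (prefix_of \<omega> n)) at_top sequentially" if \<omega>: "\<omega> \<in> A" for \<omega>
  proof (subst filterlim_at_top, rule allI)
    fix Z :: real
    obtain N where N: "Z \<le> real N"
      using real_arch_simple by blast
    obtain j where j: "2 ^ N \<le> U (prefix_of \<omega> j)"
      using unbounded[OF \<omega>] by blast
    have "Z \<le> V (prefix_of \<omega> n)" if "j \<le> n" for n
    proof -
      have "1 \<le> (1/2) ^ Suc i * M i (prefix_of \<omega> n)" if "i < N" for i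
      proof -
        have "(2::real) ^ Suc i \<le> 2 ^ N"
          using that by (intro power_increasing) auto
        then have "2 ^ Suc i \<le> M i (prefix_of \<omega> n)"
          unfolding M_def using j \<open>j \<le> n\<close> by (intro stopped_at_level_reached) auto
        then have "(1/2) ^ Suc i * 2 ^ Suc i \<le> (1/2) ^ Suc i * M i (prefix_of \<omega> n)"
          by (intro mult_left_mono) auto
        then show ?thesis
          by (simp add: power_one_over)
      qed
      then have "(\<Sum>i<N. 1) \<le> (\<Sum>i<N. (1/2) ^ Suc i * M i (prefix_of \<omega> n))"
        by (intro sum_mono) auto
      then show ?thesis
        using N mixture(2)[where s = "prefix_of \<omega> n" and n = N] by simp
    qed
    then show "\<forall>\<^sub>F n in sequentially. Z \<le> V (prefix_of \<omega> n)"
      by (auto simp: eventually_sequentially)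
  qed
  then show ?thesis
    unfolding strictly_null_def using mixture(1) by blast
qed

section \<open>A betting strategy against small time averages\<close>

lemma lower_transition_lower_expectation:
  assumes "imprecise_Markov_chain Q"
  shows "lower_expectation (Q s)"
  using assms by (simp add: imprecise_Markov_chain_def imprecise_probability_tree_def)

lemma imprecise_Markov_chain_last:
  assumes "imprecise_Markov_chain Q" and "s \<noteq> []"
  shows "Q s g = lower_transition Q g (last s)"
  using assms unfolding imprecise_Markov_chain_def lower_transition_def by metis

text \<open>Up to the error \<open>\<delta>\<close>, the function \<open>h\<close> is a one-sided solution of the Poisson equation
  \<open>T h = h - f + c\<close>. The sum of the first \<open>m\<close> iterates \<open>T ^^ j\<close> applied to \<open>f\<close> will do, once \<open>m\<close> is
  so large that \<open>(T ^^ m) f > c - \<delta>\<close>: superadditivity is the one direction that is needed.\<close>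

lemma ex_Poisson_subsolution:
  fixes Q :: "'x::finite tree"
  assumes mc: "imprecise_Markov_chain Q"
    and lim: "\<And>x. (\<lambda>n. (lower_transition Q ^^ n) f x) \<longlonglongrightarrow> c" and "0 < \<delta>"
  shows "\<exists>h. \<forall>x. h x - f x + c - \<delta> \<le> lower_transition Q h x"
proof -
  let ?T = "lower_transition Q"
  have "\<forall>\<^sub>F n in sequentially. \<forall>x. c - \<delta> < (?T ^^ n) f x"
    using lim \<open>0 < \<delta>\<close> by (intro eventually_all_finite order_tendstoD(1)) auto
  then obtain m where m: "c - \<delta> < (?T ^^ m) f x" for x
    by (auto simp: eventually_sequentially)
  define h where "h x = (\<Sum>j<m. (?T ^^ j) f x)" for x
  have "h x - f x + c - \<delta> \<le> ?T h x" for x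
  proof -
    have "h x - f x + (?T ^^ m) f x = (\<Sum>j<m. (?T ^^ Suc j) f x)"
      unfolding h_def using sum_lessThan_telescope[of "\<lambda>j. (?T ^^ j) f x" m]
      by (simp add: sum_subtractf)
    also have "\<dots> = (\<Sum>j<m. Q [x] ((?T ^^ j) f))"
      by (simp add: lower_transition_def)
    also have "\<dots> \<le> Q [x] h"
      unfolding h_def
      by (rule lower_expectation_sum_superadditive[OF lower_transition_lower_expectation[OF mc]])
    finally show ?thesis
      using m[of x] by (simp add: lower_transition_def)
  qed
  then show ?thesis by blast
qed

text \<open>The capital obtained by betting, at each time, the proportion \<open>\<xi>\<close> of the current capital
  on \<open>- D x y\<close>, where \<open>x\<close> is the current state and \<open>y\<close> the next one. No bet is made on the initial
  state.\<close>

definition betting_process :: "('x \<Rightarrow> 'x \<Rightarrow> real) \<Rightarrow> real \<Rightarrow> 'x process" where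
  "betting_process D \<xi> s = (\<Prod>k<length s - 1. 1 - \<xi> * D (s ! k) (s ! Suc k))"

lemma betting_process_snoc:
  assumes "s \<noteq> []"
  shows "betting_process D \<xi> (s @ [x]) = betting_process D \<xi> s * (1 - \<xi> * D (last s) x)"
proof -
  obtain n where n: "length s = Suc n"
    using assms by (cases s) auto
  then show ?thesis
    using assms by (simp add: betting_process_def nth_append last_conv_nth)
qed

lemma betting_process_prefix_of:
  "betting_process D \<xi> (prefix_of \<omega> (Suc n)) = (\<Prod>k<n. 1 - \<xi> * D (\<omega> k) (\<omega> (Suc k)))"
  by (auto simp: betting_process_def prefix_of_def nth_append intro!: prod.cong
      simp del: upt_Suc)

lemma test_supermartingale_betting_process:
  fixes Q :: "'x::finite tree"
  assumes mc: "imprecise_Markov_chain Q" and "0 \<le> \<xi>"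
    and small: "\<And>x y. \<bar>\<xi> * D x y\<bar> \<le> 1"
    and D: "\<And>x. 0 \<le> lower_transition Q (D x) x"
  shows "test_supermartingale Q (betting_process D \<xi>)"
proof -
  let ?M = "betting_process D \<xi>"
  note E = lower_transition_lower_expectation[OF mc]
  have nonneg: "0 \<le> ?M s" for s
    unfolding betting_process_def
    by (rule prod_nonneg) (use small abs_le_D1 in auto)
  have "0 \<le> Q s (\<lambda>x. ?M s - ?M (s @ [x]))" for s
  proof (cases "s = []")
    case True
    then show ?thesis
      by (simp add: betting_process_def lower_expectation_zero[OF E])
  next
    case False
    have "Q s (\<lambda>x. ?M s - ?M (s @ [x])) = Q s (\<lambda>x. (?M s * \<xi>) * D (last s) x)"
      by (simp add: betting_process_snoc[OF False] algebra_simps)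
    also have "\<dots> = (?M s * \<xi>) * Q s (D (last s))"
      using nonneg[of s] \<open>0 \<le> \<xi>\<close> by (subst lower_expectation_scale[OF E]) auto
    also have "0 \<le> \<dots>"
      using nonneg[of s] \<open>0 \<le> \<xi>\<close> D[of "last s"]
      by (simp add: imprecise_Markov_chain_last[OF mc False])
    finally show ?thesis .
  qed
  then show ?thesis
    using nonneg by (simp add: test_supermartingale_def supermartingale_iff betting_process_def)
qed

lemma betting_process_le:
  assumes small: "\<And>x y. \<bar>\<xi> * D x y\<bar> \<le> 1"
  shows "betting_process D \<xi> s \<le> 2 ^ length s"
proof -
  have "betting_process D \<xi> s \<le> (\<Prod>k<length s - 1. 2)"
    unfolding betting_process_def
    by (rule prod_mono) (use small in \<open>force simp: abs_le_iff\<close>)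
  also have "\<dots> \<le> 2 ^ length s"
    by (simp add: power_increasing)
  finally show ?thesis .
qed

lemma exp_le_one_minus:
  fixes x :: real
  assumes "\<bar>x\<bar> \<le> 1/2"
  shows "exp (- x - 2 * x\<^sup>2) \<le> 1 - x"
proof -
  have "\<bar>ln (1 + - x) - - x\<bar> \<le> 2 * (- x)\<^sup>2"
    by (rule abs_ln_one_plus_x_minus_x_bound) (use assms in simp)
  then have "- x - 2 * x\<^sup>2 \<le> ln (1 - x)"
    by simp
  moreover have "0 < 1 - x"
    using assms by simp
  ultimately show ?thesis
    by (metis exp_ln exp_le_cancel_iff)
qed

lemma betting_process_ge:
  assumes "\<And>x y. \<bar>D x y\<bar> \<le> B" and "0 \<le> \<xi>" and "\<xi> * B \<le> 1/2"
  shows "exp (- \<xi> * (\<Sum>k<n. D (\<omega> k) (\<omega> (Suc k))) - 2 * (\<xi> * B)\<^sup>2 * real n)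
    \<le> betting_process D \<xi> (prefix_of \<omega> (Suc n))"
proof -
  let ?d = "\<lambda>k. \<xi> * D (\<omega> k) (\<omega> (Suc k))"
  have d: "\<bar>?d k\<bar> \<le> \<xi> * B" for k
    using assms(1,2) by (simp add: abs_mult mult_left_mono)
  have "- \<xi> * (\<Sum>k<n. D (\<omega> k) (\<omega> (Suc k))) - 2 * (\<xi> * B)\<^sup>2 * real n
      = (\<Sum>k<n. - ?d k - 2 * (\<xi> * B)\<^sup>2)"
    by (simp add: sum_subtractf sum_negf sum_distrib_left)
  also have "exp \<dots> = (\<Prod>k<n. exp (- ?d k - 2 * (\<xi> * B)\<^sup>2))"
    by (simp add: exp_sum)
  also have "\<dots> \<le> (\<Prod>k<n. 1 - ?d k)"
  proof (rule prod_mono, intro conjI)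
    fix k
    have "(?d k)\<^sup>2 \<le> (\<xi> * B)\<^sup>2"
      using power_mono[OF d, of k 2] by simp
    then have "exp (- ?d k - 2 * (\<xi> * B)\<^sup>2) \<le> exp (- ?d k - 2 * (?d k)\<^sup>2)"
      by simp
    also have "\<dots> \<le> 1 - ?d k"
      by (rule exp_le_one_minus) (use d[of k] assms(3) in linarith)
    finally show "exp (- ?d k - 2 * (\<xi> * B)\<^sup>2) \<le> 1 - ?d k" .
  qed simp
  finally show ?thesis
    by (simp add: betting_process_prefix_of)
qed

text \<open>The bets are on the increments \<open>h y - h x + f x - (c - \<delta>)\<close>, which have non-negative
  lower expectation given \<open>x\<close> by the choice of \<open>h\<close> and sum to \<open>\<Sum>k\<le>n. (f X\<^sub>k - c + \<delta>)\<close> up to a bounded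
  telescoping term.\<close>

lemma ex_test_supermartingale_small_averages:
  fixes Q :: "'x::finite tree" and f :: "'x gamble"
  assumes mc: "imprecise_Markov_chain Q"
    and lim: "\<And>x. (\<lambda>n. (lower_transition Q ^^ n) f x) \<longlonglongrightarrow> c" and "0 < \<delta>"
  shows "\<exists>M. test_supermartingale Q M \<and> (\<forall>s. M s \<le> 2 ^ length s) \<and>
    (\<forall>\<omega>. (\<exists>\<^sub>F n in sequentially. (\<Sum>k<n. f (\<omega> k)) \<le> real n * (c - 3 * \<delta>)) \<longrightarrow>
      (\<forall>L. \<exists>n. L \<le> M (prefix_of \<omega> n)))"
proof -
  obtain h where h: "h x - f x + c - \<delta> \<le> lower_transition Q h x" for x
    using ex_Poisson_subsolution[OF mc lim \<open>0 < \<delta>\<close>] by blast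
  define D where "D x y = h y + (f x - h x - (c - \<delta>))" for x y
  have D: "0 \<le> lower_transition Q (D x) x" for x
  proof -
    have "lower_transition Q (D x) x = lower_transition Q h x + (f x - h x - (c - \<delta>))"
      unfolding lower_transition_def D_def
      by (rule lower_expectation_add_const[OF lower_transition_lower_expectation[OF mc]])
    then show ?thesis
      using h[of x] by simp
  qed
  define H where "H = Max (range (\<lambda>x. \<bar>h x\<bar>))"
  have H: "\<bar>h x\<bar> \<le> H" for x
    unfolding H_def by (rule Max_ge) auto
  define B where "B = 1 + Max (range (\<lambda>(x, y). \<bar>D x y\<bar>))"
  have B': "\<bar>D x y\<bar> \<le> B - 1" for x y
  proof -
    have "\<bar>D x y\<bar> \<le> Max (range (\<lambda>(x, y). \<bar>D x y\<bar>))"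
      by (rule Max_ge) (auto intro: image_eqI[where x = "(x, y)"])
    then show ?thesis by (simp add: B_def)
  qed
  from this[of undefined undefined] have "1 \<le> B"
    by linarith
  have B: "\<bar>D x y\<bar> \<le> B" for x y
    using B'[of x y] by linarith
  \<comment> \<open>The second bound on the stake leaves a growth rate \<open>\<xi> \<delta> / 2\<close> after the quadratic loss
    \<open>2 \<xi>\<^sup>2 B\<^sup>2\<close> is subtracted from the gain \<open>\<xi> \<delta>\<close>.\<close>
  define \<xi> where "\<xi> = min (1 / (2 * B)) (\<delta> / (4 * B\<^sup>2))"
  have "0 < \<xi>" "\<xi> * B \<le> 1/2" "4 * \<xi> * B\<^sup>2 \<le> \<delta>"
    using \<open>1 \<le> B\<close> \<open>0 < \<delta>\<close> by (auto simp: \<xi>_def min_def field_simps)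
  have small: "\<bar>\<xi> * D x y\<bar> \<le> 1" for x y
  proof -
    have "\<bar>\<xi> * D x y\<bar> \<le> \<xi> * B"
      using \<open>0 < \<xi>\<close> B[of x y] by (simp add: abs_mult)
    then show ?thesis using \<open>\<xi> * B \<le> 1/2\<close> by simp
  qed
  let ?M = "betting_process D \<xi>"
  have "\<exists>n. L \<le> ?M (prefix_of \<omega> n)"
    if freq: "\<exists>\<^sub>F n in sequentially. (\<Sum>k<n. f (\<omega> k)) \<le> real n * (c - 3 * \<delta>)" for \<omega> L
  proof -
    obtain n0 where n0: "2 * H / \<delta> + 2 * \<bar>L\<bar> / (\<xi> * \<delta>) \<le> real n0"
      using real_arch_simple by blast
    obtain n where "n0 \<le> n" and n: "(\<Sum>k<n. f (\<omega> k)) \<le> real n * (c - 3 * \<delta>)"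
      using freq unfolding frequently_sequentially by blast
    have "0 \<le> H" using order_trans[OF abs_ge_zero H] .
    have "2 * H / \<delta> \<le> real n" "2 * \<bar>L\<bar> / (\<xi> * \<delta>) \<le> real n"
      using n0 \<open>n0 \<le> n\<close> \<open>0 \<le> H\<close> \<open>0 < \<xi>\<close> \<open>0 < \<delta>\<close>
      by (smt (verit) divide_nonneg_pos mult_pos_pos of_nat_le_iff)+
    then have nH: "2 * H \<le> \<delta> * real n" and nL: "\<bar>L\<bar> \<le> \<xi> * \<delta> * real n / 2"
      using \<open>0 < \<xi>\<close> \<open>0 < \<delta>\<close> by (auto simp: field_simps)
    have "(\<Sum>k<n. D (\<omega> k) (\<omega> (Suc k)))
        = (\<Sum>k<n. h (\<omega> (Suc k)) - h (\<omega> k)) + (\<Sum>k<n. f (\<omega> k)) - real n * (c - \<delta>)"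
      by (simp add: D_def sum.distrib sum_subtractf algebra_simps)
    also have "(\<Sum>k<n. h (\<omega> (Suc k)) - h (\<omega> k)) = h (\<omega> n) - h (\<omega> 0)"
      by (rule sum_lessThan_telescope)
    finally have "(\<Sum>k<n. D (\<omega> k) (\<omega> (Suc k))) \<le> 2 * H - 2 * \<delta> * real n"
      using n H[of "\<omega> n"] H[of "\<omega> 0"] by (simp add: algebra_simps)
    with nH have "(\<Sum>k<n. D (\<omega> k) (\<omega> (Suc k))) \<le> - (\<delta> * real n)"
      by simp
    then have "\<xi> * (\<Sum>k<n. D (\<omega> k) (\<omega> (Suc k))) \<le> \<xi> * - (\<delta> * real n)"
      using \<open>0 < \<xi>\<close> by (intro mult_left_mono) auto
    moreover have "2 * (\<xi> * B)\<^sup>2 * real n \<le> \<xi> * \<delta> * real n / 2"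
      using mult_right_mono[OF mult_left_mono[OF \<open>4 * \<xi> * B\<^sup>2 \<le> \<delta>\<close>, of \<xi>], of "real n"] \<open>0 < \<xi>\<close>
      by (simp add: power2_eq_square algebra_simps)
    ultimately have "L \<le> - \<xi> * (\<Sum>k<n. D (\<omega> k) (\<omega> (Suc k))) - 2 * (\<xi> * B)\<^sup>2 * real n"
      using nL by simp
    also have "\<dots> \<le> exp \<dots>"
      using exp_ge_add_one_self[of "- \<xi> * (\<Sum>k<n. D (\<omega> k) (\<omega> (Suc k))) - 2 * (\<xi> * B)\<^sup>2 * real n"]
      by linarith
    also have "\<dots> \<le> ?M (prefix_of \<omega> (Suc n))"
      by (rule betting_process_ge) (use B \<open>0 < \<xi>\<close> \<open>\<xi> * B \<le> 1/2\<close> in auto)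
    finally show ?thesis by blast
  qed
  moreover have "test_supermartingale Q ?M"
    using test_supermartingale_betting_process[OF mc less_imp_le[OF \<open>0 < \<xi>\<close>] small D] .
  moreover have "?M s \<le> 2 ^ length s" for s
    by (rule betting_process_le[OF small])
  ultimately show ?thesis by blast
qed

section \<open>Global lower expectations of a single state\<close>

lemma submartingale_le:
  assumes E: "lower_expectation (Q s)" and M: "submartingale Q M"
  shows "M s \<le> Q s (\<lambda>x. M (s @ [x]))"
proof -
  have "0 \<le> Q s (\<lambda>x. M (s @ [x]) + - M s)"
    using M by (simp add: submartingale_def process_difference_def)
  then show ?thesis
    unfolding lower_expectation_add_const[OF E] by simp
qed

lemma submartingale_ex_successor:
  fixes Q :: "'x::finite tree"
  assumes E: "lower_expectation (Q s)" and M: "submartingale Q M"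
  shows "\<exists>x. M s \<le> M (s @ [x])"
proof -
  let ?m = "Max (range (\<lambda>x. M (s @ [x])))"
  have "M s \<le> Q s (\<lambda>x. M (s @ [x]))"
    by (rule submartingale_le[OF assms])
  also have "\<dots> \<le> Q s (\<lambda>x. ?m)"
    by (rule lower_expectation_mono[OF E]) simp
  also have "\<dots> = ?m"
    by (rule lower_expectation_const[OF E])
  finally have "M s \<le> ?m" .
  moreover have "?m \<in> range (\<lambda>x. M (s @ [x]))"
    by (rule Max_in) auto
  ultimately show ?thesis by force
qed

lemma submartingale_ex_nondecreasing_path:
  fixes Q :: "'x::finite tree"
  assumes Q: "imprecise_probability_tree Q" and M: "submartingale Q M"
  shows "\<exists>\<omega>. prefix_of \<omega> (length s) = s \<and> (\<forall>n\<ge>length s. M s \<le> M (prefix_of \<omega> n))"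
proof -
  have "\<exists>x. M t \<le> M (t @ [x])" for t
    using submartingale_ex_successor[OF _ M] Q by (simp add: imprecise_probability_tree_def)
  then obtain nxt where nxt: "M t \<le> M (t @ [nxt t])" for t
    by metis
  define t where "t n = ((\<lambda>r. r @ [nxt r]) ^^ n) s" for n
  have t_Suc: "t (Suc n) = t n @ [nxt (t n)]" for n
    by (simp add: t_def)
  define \<omega> where "\<omega> i = (if i < length s then s ! i else nxt (t (i - length s)))" for i
  have prefix: "prefix_of \<omega> (length s + n) = t n" for n
  proof (induction n)
    case 0
    then show ?case
      by (auto simp: prefix_of_def t_def \<omega>_def intro: nth_equalityI)
  next
    case (Suc n)
    then show ?case
      by (simp add: prefix_of_Suc t_Suc \<omega>_def)
  qed
  have mono: "M s \<le> M (t n)" for n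
  proof (induction n)
    case 0
    then show ?case by (simp add: t_def)
  next
    case (Suc n)
    then show ?case using nxt[of "t n"] by (simp add: t_Suc)
  qed
  have "M s \<le> M (prefix_of \<omega> n)" if "length s \<le> n" for n
    using mono[of "n - length s"] prefix[of "n - length s"] that by simp
  moreover have "prefix_of \<omega> (length s) = s"
    using prefix[of 0] by (simp add: t_def)
  ultimately show ?thesis by blast
qed

text \<open>Backward induction along a submartingale gives the upper half of the identity
  \<open>E\<^sub>k f = E\<^sub>1 ((T ^^ (k - 1)) f)\<close>, here weakened to a bound that does not involve the marginal model.\<close>

lemma lower_expectation_at_le:
  fixes Q :: "'x::finite tree" and f :: "'x gamble"
  assumes mc: "imprecise_Markov_chain Q"
    and b: "\<And>x. (lower_transition Q ^^ n) f x \<le> b"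
  shows "lower_expectation_at Q (Suc n) f \<le> b"
  unfolding lower_expectation_at_def
proof (rule cSup_least)
  let ?T = "lower_transition Q"
  note E = lower_transition_lower_expectation[OF mc]
  let ?S = "{M [] |M. submartingale Q M \<and>
    (\<forall>\<omega>. limsup (\<lambda>n. ereal (M (prefix_of \<omega> n))) \<le> ereal (f (state_at (Suc n) \<omega>)))}"
  have "submartingale Q (\<lambda>s. Min (range f))"
    by (simp add: submartingale_def process_difference_def lower_expectation_zero[OF E])
  then have "Min (range f) \<in> ?S"
    by (force simp: Limsup_const)
  then show "?S \<noteq> {}" by blast
  fix v
  assume "v \<in> ?S"
  then obtain M where v: "v = M []" and M: "submartingale Q M"
    and limsup: "\<And>\<omega>. limsup (\<lambda>i. ereal (M (prefix_of \<omega> i))) \<le> ereal (f (state_at (Suc n) \<omega>))"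
    by blast
  have final: "M s \<le> f (last s)" if len: "length s = Suc n" for s
  proof -
    obtain \<omega> where \<omega>: "prefix_of \<omega> (length s) = s" "\<And>i. length s \<le> i \<Longrightarrow> M s \<le> M (prefix_of \<omega> i)"
      using submartingale_ex_nondecreasing_path[OF _ M] mc
      unfolding imprecise_Markov_chain_def by blast
    have "ereal (M s) \<le> liminf (\<lambda>i. ereal (M (prefix_of \<omega> i)))"
      by (rule Liminf_bounded) (use \<omega>(2) in \<open>auto simp: eventually_sequentially\<close>)
    also have "\<dots> \<le> limsup (\<lambda>i. ereal (M (prefix_of \<omega> i)))"
      by (rule Liminf_le_Limsup) simp
    also have "\<dots> \<le> ereal (f (\<omega> n))"
      using limsup[of \<omega>] by (simp add: state_at_def)
    also have "\<omega> n = last s"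
      using \<omega>(1) len by (metis last_snoc prefix_of_Suc)
    finally show ?thesis by simp
  qed
  have backward: "M s \<le> (?T ^^ j) f (last s)" if "length s + j = Suc n" "s \<noteq> []" for s j
    using that
  proof (induction j arbitrary: s)
    case 0
    then show ?case using final by simp
  next
    case (Suc j)
    have "M s \<le> Q s (\<lambda>x. M (s @ [x]))"
      by (rule submartingale_le[OF E M])
    also have "\<dots> \<le> Q s ((?T ^^ j) f)"
      by (rule lower_expectation_mono[OF E]) (use Suc.IH[of "s @ [_]"] Suc.prems in simp)
    also have "\<dots> = (?T ^^ Suc j) f (last s)"
      by (simp add: imprecise_Markov_chain_last[OF mc \<open>s \<noteq> []\<close>])
    finally show ?case .
  qed
  obtain x where "M [] \<le> M [x]"
    using submartingale_ex_successor[OF E M, of "[]"] by auto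
  also have "\<dots> \<le> (?T ^^ n) f x"
    using backward[of "[x]" n] by simp
  also have "\<dots> \<le> b" by (rule b)
  finally show "v \<le> b" by (simp add: v)
qed

section \<open>Time averages\<close>

lemma liminf_ereal_ge_iff:
  "ereal c \<le> liminf (\<lambda>n. ereal (a n)) \<longleftrightarrow> (\<forall>\<epsilon>>0. \<forall>\<^sub>F n in sequentially. c - \<epsilon> < a n)"
  (is "?L \<longleftrightarrow> ?R")
proof
  assume ?L
  then show ?R
    by (auto simp: le_Liminf_iff dest: spec[of _ "ereal (c - _)"])
next
  assume R: ?R
  have "\<forall>\<^sub>F n in sequentially. y < ereal (a n)" if "y < ereal c" for y
  proof (cases y)
    case (real r)
    then show ?thesis
      using that R[rule_format, of "c - r"] by simp
  qed (use that in auto)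
  then show ?L
    by (simp add: le_Liminf_iff)
qed

lemma average_eventually_less:
  fixes e :: "nat \<Rightarrow> real"
  assumes "\<And>\<delta>. 0 < \<delta> \<Longrightarrow> \<forall>\<^sub>F n in sequentially. e n \<le> c + \<delta>" and "0 < \<epsilon>"
  shows "\<forall>\<^sub>F n in sequentially. (1 / real n) * (\<Sum>k=1..n. e k) < c + \<epsilon>"
proof -
  obtain K where K: "\<And>k. K \<le> k \<Longrightarrow> e k \<le> c + \<epsilon> / 2"
    using assms(1)[of "\<epsilon> / 2"] \<open>0 < \<epsilon>\<close> by (auto simp: eventually_sequentially)
  define C where "C = (\<Sum>k<K. \<bar>e k - (c + \<epsilon> / 2)\<bar>)"
  have C: "(\<Sum>k=1..n. e k - (c + \<epsilon> / 2)) \<le> C" for n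
  proof -
    have "(\<Sum>k=1..n. e k - (c + \<epsilon> / 2))
        \<le> (\<Sum>k=1..n. if k < K then \<bar>e k - (c + \<epsilon> / 2)\<bar> else 0)"
      using K by (intro sum_mono) (auto simp: not_less)
    also have "\<dots> = (\<Sum>k\<in>{1..n} \<inter> {..<K}. \<bar>e k - (c + \<epsilon> / 2)\<bar>)"
      by (simp add: sum.If_cases lessThan_def)
    also have "\<dots> \<le> C"
      unfolding C_def by (rule sum_mono2) auto
    finally show ?thesis .
  qed
  obtain N where N: "2 * C / \<epsilon> < real N"
    using reals_Archimedean2 by blast
  have "(1 / real n) * (\<Sum>k=1..n. e k) < c + \<epsilon>" if "Suc N \<le> n" for n
  proof -
    have "0 < real n" "2 * C / \<epsilon> < real n"
      using that N by auto
    then have "2 * C < \<epsilon> * real n"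
      using \<open>0 < \<epsilon>\<close> by (simp add: field_simps)
    moreover have "(\<Sum>k=1..n. e k) \<le> C + real n * (c + \<epsilon> / 2)"
      using C[of n] by (simp add: sum_subtractf)
    ultimately have "(\<Sum>k=1..n. e k) < real n * (c + \<epsilon>)"
      by (simp add: algebra_simps)
    then show ?thesis
      using \<open>0 < real n\<close> by (simp add: field_simps)
  qed
  then show ?thesis
    by (auto simp: eventually_sequentially)
qed

lemma limit_expectation_tendsto:
  assumes "Perron_Frobenius_like T"
  shows "(\<lambda>n. (T ^^ n) f x) \<longlonglongrightarrow> limit_expectation T f"
proof -
  obtain c where c: "\<forall>x. (\<lambda>n. (T ^^ n) f x) \<longlonglongrightarrow> c"
    using assms unfolding Perron_Frobenius_like_def by blast
  then have "limit_expectation T f = c"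
    unfolding limit_expectation_def by (intro the_equality) (auto intro: LIMSEQ_unique)
  with c show ?thesis by simp
qed

lemma sum_state_at: "(\<Sum>k=1..n. f (state_at k \<omega>)) = (\<Sum>k<n. f (\<omega> k))"
  by (induction n) (auto simp: state_at_def)

lemma strictly_null_mono:
  "strictly_null Q B \<Longrightarrow> A \<subseteq> B \<Longrightarrow> strictly_null Q A"
  unfolding strictly_null_def by blast

lemma strictly_almost_surely_average:
  fixes Q :: "'x::finite tree" and f :: "'x gamble"
  assumes mc: "imprecise_Markov_chain Q"
    and lim: "\<And>x. (\<lambda>n. (lower_transition Q ^^ n) f x) \<longlonglongrightarrow> c"
  shows "strictly_almost_surely Q (\<lambda>\<omega>.
    ereal c \<le> liminf (\<lambda>n. ereal ((1 / real n) * (\<Sum>k=1..n. f (state_at k \<omega>)))))"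
proof -
  let ?small = "\<lambda>\<delta> \<omega>. \<exists>\<^sub>F n in sequentially. (\<Sum>k<n. f (\<omega> k)) \<le> real n * (c - 3 * \<delta>)"
  have Q: "imprecise_probability_tree Q"
    using mc by (simp add: imprecise_Markov_chain_def)
  have "\<forall>i. \<exists>M. test_supermartingale Q M \<and> (\<forall>s. M s \<le> 2 ^ length s) \<and>
    (\<forall>\<omega>. ?small (inverse (real (Suc i))) \<omega> \<longrightarrow> (\<forall>L. \<exists>n. L \<le> M (prefix_of \<omega> n)))"
    using ex_test_supermartingale_small_averages[OF mc lim] by simp
  then obtain M where M: "\<And>i. test_supermartingale Q (M i)" "\<And>i s. M i s \<le> 2 ^ length s"
    and unbounded: "\<And>i \<omega> L. ?small (inverse (real (Suc i))) \<omega> \<Longrightarrow> \<exists>n. L \<le> M i (prefix_of \<omega> n)"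
    by metis
  let ?U = "\<lambda>s. \<Sum>i. (1/2) ^ Suc i * M i s"
  note mixture = test_supermartingale_mixture[where Q = Q and M = M and B = "\<lambda>s. 2 ^ length s",
      OF Q M]
  show ?thesis
    unfolding strictly_almost_surely_def
  proof (rule strictly_null_if_unbounded[OF Q mixture(1)])
    fix \<omega> L
    assume "\<omega> \<in> {\<omega>. \<not> ereal c \<le> liminf (\<lambda>n. ereal ((1 / real n) * (\<Sum>k=1..n. f (state_at k \<omega>))))}"
    then obtain \<epsilon> where "0 < \<epsilon>"
      and freq: "\<exists>\<^sub>F n in sequentially. (1 / real n) * (\<Sum>k<n. f (\<omega> k)) \<le> c - \<epsilon>"
      unfolding liminf_ereal_ge_iff sum_state_at mem_Collect_eq frequently_def
      by (auto simp: not_le)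
    obtain i where i: "inverse (real (Suc i)) < \<epsilon> / 3"
      using reals_Archimedean[of "\<epsilon> / 3"] \<open>0 < \<epsilon>\<close> by auto
    have "?small (inverse (real (Suc i))) \<omega>"
    proof (rule frequently_mp[OF _ frequently_eventually_conj[OF freq eventually_gt_at_top[of 0]]],
        rule always_eventually, intro allI impI)
      fix n
      assume "0 < n \<and> (1 / real n) * (\<Sum>k<n. f (\<omega> k)) \<le> c - \<epsilon>"
      then have "(\<Sum>k<n. f (\<omega> k)) \<le> real n * (c - \<epsilon>)"
        by (auto simp: pos_divide_le_eq mult.commute)
      also have "\<dots> \<le> real n * (c - 3 * inverse (real (Suc i)))"
        using i by (intro mult_left_mono) auto
      finally show "(\<Sum>k<n. f (\<omega> k)) \<le> real n * (c - 3 * inverse (real (Suc i)))" .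
    qed
    then obtain n where "2 ^ Suc i * L \<le> M i (prefix_of \<omega> n)"
      using unbounded by blast
    then have "(1/2) ^ Suc i * (2 ^ Suc i * L) \<le> (1/2) ^ Suc i * M i (prefix_of \<omega> n)"
      by (intro mult_left_mono) auto
    then have "L \<le> (1/2) ^ Suc i * M i (prefix_of \<omega> n)"
      by (simp add: power_one_over)
    also have "\<dots> \<le> ?U (prefix_of \<omega> n)"
      by (rule mixture(3))
    finally show "\<exists>n. L \<le> ?U (prefix_of \<omega> n)" by blast
  qed
qed

theorem theorem32:
  fixes Q :: "'x::finite tree"
  assumes "imprecise_Markov_chain Q"
    and "Perron_Frobenius_like (lower_transition Q)"
  shows "\<forall>f :: 'x gamble.
      strictly_almost_surely Q (\<lambda>\<omega>.
        liminf (\<lambda>n. ereal ((1 / real n) *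
          (\<Sum>k=1..n. (f (state_at k \<omega>) - lower_expectation_at Q k f)))) \<ge> 0) \<and>
      strictly_almost_surely Q (\<lambda>\<omega>.
        liminf (\<lambda>n. ereal ((1 / real n) * (\<Sum>k=1..n. f (state_at k \<omega>))))
          \<ge> ereal (limit_expectation (lower_transition Q) f))"
proof (intro allI conjI)
  fix f :: "'x gamble"
  let ?T = "lower_transition Q"
  let ?c = "limit_expectation ?T f"
  let ?e = "\<lambda>k. lower_expectation_at Q k f"
  let ?a = "\<lambda>\<omega> n. (1 / real n) * (\<Sum>k=1..n. f (state_at k \<omega>))"
  have lim: "(\<lambda>n. (?T ^^ n) f x) \<longlonglongrightarrow> ?c" for x
    by (rule limit_expectation_tendsto[OF assms(2)])
  show second: "strictly_almost_surely Q (\<lambda>\<omega>. ereal ?c \<le> liminf (\<lambda>n. ereal (?a \<omega> n)))"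
    by (rule strictly_almost_surely_average[OF assms(1) lim])
  have e: "\<forall>\<^sub>F n in sequentially. ?e n \<le> ?c + \<delta>" if "0 < \<delta>" for \<delta>
  proof (subst eventually_sequentially_Suc[symmetric])
    have "\<forall>\<^sub>F n in sequentially. \<forall>x. (?T ^^ n) f x < ?c + \<delta>"
      using lim that by (intro eventually_all_finite order_tendstoD(2)) auto
    then show "\<forall>\<^sub>F n in sequentially. ?e (Suc n) \<le> ?c + \<delta>"
      by (rule eventually_mono) (auto intro: lower_expectation_at_le[OF assms(1)] less_imp_le)
  qed
  have "ereal 0 \<le> liminf (\<lambda>n. ereal ((1 / real n) * (\<Sum>k=1..n. f (state_at k \<omega>) - ?e k)))"
    if "ereal ?c \<le> liminf (\<lambda>n. ereal (?a \<omega> n))" for \<omega>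
    unfolding liminf_ereal_ge_iff
  proof (intro allI impI)
    fix \<epsilon> :: real
    assume "0 < \<epsilon>"
    then have "\<forall>\<^sub>F n in sequentially. ?c - \<epsilon> / 2 < ?a \<omega> n"
      using that[unfolded liminf_ereal_ge_iff, rule_format, of "\<epsilon> / 2"] by simp
    moreover have "\<forall>\<^sub>F n in sequentially. (1 / real n) * (\<Sum>k=1..n. ?e k) < ?c + \<epsilon> / 2"
      using \<open>0 < \<epsilon>\<close> by (intro average_eventually_less e) auto
    ultimately show "\<forall>\<^sub>F n in sequentially.
        0 - \<epsilon> < (1 / real n) * (\<Sum>k=1..n. f (state_at k \<omega>) - ?e k)"
      by eventually_elim (simp add: sum_subtractf right_diff_distrib diff_divide_distrib)
  qed
  then show "strictly_almost_surely Q (\<lambda>\<omega>.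
      0 \<le> liminf (\<lambda>n. ereal ((1 / real n) * (\<Sum>k=1..n. f (state_at k \<omega>) - ?e k))))"
    using second unfolding strictly_almost_surely_def
    by (elim strictly_null_mono) (auto simp: zero_ereal_def)
qed

end
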